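(* Let $\kappa>0$, $n\in\{1,2,\dots\}$, $\nu\in\{+,-\}$, and let $u$ be an $S_n^\nu$-solution, for some $\lambda\in(0,\infty)$, of $$-\Big(\frac{u'(x)}{\sqrt{1+\kappa (u'(x))^2}}\Big)'=\lambda u(x),\quad 0<x<1,\qquad u(0)=u(1)=0.$$ Then $0<\lambda<n^2\pi^2$. Moreover: (1) All the positive bumps of $u$ have the same shape, and any such bump $B$ satisfies: (i) $B$ is symmetric about its mid-point $m_B$; (ii) $u'$ is strictly decreasing on $B$, so $B$ contains exactly one zero of $u'$, at $m_B$. (2) All the negative bumps of $u$ have the same shape, and any such bump $D$ satisfies: (i) $D$ is symmetric about its mid-point $m_D$; (ii) $u'$ is strictly increasing on $D$, so $D$ contains exactly one zero of $u'$, at $m_D$. (3) The positive and negative bumps have the same shape.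
   Context: $C^1_0[0,1]$ is the space of $C^1$ functions on $[0,1]$ vanishing at $0$ and $1$. For $n\in\{1,2,\dots\}$ and $\nu\in\{+,-\}$, $$S_n^\nu:=\{u\in C_0^1[0,1] : u \text{ has exactly } n-1 \text{ simple zeros in } (0,1), \text{ and } \nu u \text{ is positive near } 0\}$$ (positive near $0$ means on some interval $(0,\varepsilon)$; $\nu$ is identified with $\pm1$). A zero $\tau$ of $u$ is simple if $u'(\tau)\neq0$. An $S_n^\nu$-solution is a (classical, $C^2$) solution $u$ with $u\in S_n^\nu$. A positive (negative) bump of $u$ is (the restriction of $u$ to) a maximal interval on which $u>0$ ($u<0$). A bump on an interval $(x_l,x_r)$ is symmetric about its mid-point if $u(x)=u(x_l+x_r-x)$ there. Two bumps of the same sign have the same shape if one is a translate in $x$ of the other; a positive and a negative bump have the same shape if one is a translate in $x$ of the negative of the other. *)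

theory Defs
  imports "HOL-Analysis.Analysis"
begin

text \<open>
  A function on \<open>[0,1]\<close> is represented by a total function \<open>real \<Rightarrow> real\<close> of which only the
  restriction to \<open>{0..1}\<close> matters. Accordingly, derivatives are taken within \<open>{0..1}\<close>:
  one-sided at the end-points, the ordinary derivative in the interior.
\<close>

definition D01 :: "(real \<Rightarrow> real) \<Rightarrow> real \<Rightarrow> real" where
  "D01 u x = vector_derivative u (at x within {0..1})"

definition C1 :: "(real \<Rightarrow> real) set" where
  "C1 = {u. u differentiable_on {0..1} \<and> continuous_on {0..1} (D01 u)}"

definition C2 :: "(real \<Rightarrow> real) set" where
  "C2 = {u. u \<in> C1 \<and> D01 u \<in> C1}"

definition C1_0 :: "(real \<Rightarrow> real) set" where
  "C1_0 = {u \<in> C1. u 0 = 0 \<and> u 1 = 0}"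

definition simple_zero :: "(real \<Rightarrow> real) \<Rightarrow> real \<Rightarrow> bool" where
  "simple_zero u \<tau> \<longleftrightarrow> u \<tau> = 0 \<and> D01 u \<tau> \<noteq> 0"

text \<open>
  The sign \<open>\<nu>\<close> is meant to be \<open>1\<close> or \<open>-1\<close>. Non-simple zeros are not excluded here; a solution
  of the equation below that lies in \<open>S n \<nu>\<close> cannot have any.
\<close>

definition S :: "nat \<Rightarrow> real \<Rightarrow> (real \<Rightarrow> real) set" where
  "S n \<nu> = {u \<in> C1_0.
      finite {\<tau> \<in> {0<..<1}. simple_zero u \<tau>} \<and>
      card {\<tau> \<in> {0<..<1}. simple_zero u \<tau>} = n - 1 \<and>
      (\<exists>\<epsilon>>0. \<forall>x\<in>{0<..<\<epsilon>}. \<nu> * u x > 0)}"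

definition solution :: "real \<Rightarrow> real \<Rightarrow> (real \<Rightarrow> real) \<Rightarrow> bool" where
  "solution \<kappa> lam u \<longleftrightarrow>
     u \<in> C2 \<and>
     (\<forall>x\<in>{0<..<1}.
        ((\<lambda>y. D01 u y / sqrt (1 + \<kappa> * (D01 u y)\<^sup>2)) has_real_derivative - (lam * u x)) (at x)) \<and>
     u 0 = 0 \<and> u 1 = 0"

definition maximal_interval :: "(real \<Rightarrow> bool) \<Rightarrow> real set \<Rightarrow> bool" where
  "maximal_interval P I \<longleftrightarrow>
     I \<noteq> {} \<and> is_interval I \<and> I \<subseteq> {0..1} \<and> (\<forall>x\<in>I. P x) \<and>
     (\<forall>J. is_interval J \<and> J \<subseteq> {0..1} \<and> (\<forall>x\<in>J. P x) \<and> I \<subseteq> J \<longrightarrow> J = I)"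

text \<open>A bump is identified with the interval on which it lives.\<close>

definition positive_bump :: "(real \<Rightarrow> real) \<Rightarrow> real set \<Rightarrow> bool" where
  "positive_bump u I \<longleftrightarrow> maximal_interval (\<lambda>x. u x > 0) I"

definition negative_bump :: "(real \<Rightarrow> real) \<Rightarrow> real set \<Rightarrow> bool" where
  "negative_bump u I \<longleftrightarrow> maximal_interval (\<lambda>x. u x < 0) I"

definition symmetric_on :: "(real \<Rightarrow> real) \<Rightarrow> real \<Rightarrow> real \<Rightarrow> bool" where
  "symmetric_on u l r \<longleftrightarrow> (\<forall>x\<in>{l<..<r}. u x = u (l + r - x))"

text \<open>Same shape, for two bumps of the same sign and of opposite signs respectively.\<close>

definition same_shape :: "(real \<Rightarrow> real) \<Rightarrow> real set \<Rightarrow> real set \<Rightarrow> bool" where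
  "same_shape u I J \<longleftrightarrow> (\<exists>c. J = (\<lambda>x. x + c) ` I \<and> (\<forall>x\<in>I. u (x + c) = u x))"

definition same_shape_opp :: "(real \<Rightarrow> real) \<Rightarrow> real set \<Rightarrow> real set \<Rightarrow> bool" where
  "same_shape_opp u I J \<longleftrightarrow> (\<exists>c. J = (\<lambda>x. x + c) ` I \<and> (\<forall>x\<in>I. u (x + c) = - u x))"

end

theory Submission
  imports Defs
begin

text \<open>
  Write \<open>p = u'\<close> and \<open>\<phi> = p / sqrt (1 + \<kappa> p\<^sup>2)\<close>. The equation is then the autonomous first-order
  system \<open>u' = p\<close>, \<open>\<phi>' = - \<lambda> u\<close>, and everything rests on three of its features.

  Conservation of energy: \<open>\<lambda> \<kappa> u\<^sup>2 / 2 - sqrt (1 - \<kappa> \<phi>\<^sup>2)\<close> is constant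
  (\<open>energy_conserved\<close>), so \<open>\<bar>p\<bar>\<close> takes the same value at all zeros of \<open>u\<close>, and this value is not
  \<open>0\<close> unless \<open>u\<close> vanishes identically. In particular all zeros are simple.

  Uniqueness: as long as \<open>p\<close> stays bounded, it is a Lipschitz function of \<open>\<phi>\<close>, hence a solution is determined
  by \<open>u\<close> and \<open>p\<close> at one point (\<open>solves_on_unique\<close>, by a Gronwall argument).

  Invariance: translations, the reflection \<open>x \<mapsto> l + r - x\<close> and the change of sign of \<open>u\<close>
  preserve solutions.

  On a positive bump \<open>(l, r)\<close> the flux \<open>\<phi>\<close>, and with it \<open>p\<close>, is strictly decreasing because
  \<open>\<phi>' = - \<lambda> u < 0\<close>. The energy gives \<open>p r = - p l\<close>, so that \<open>u\<close> and its reflection start from the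
  same data and coincide: the bump is symmetric. Any two bumps start, up to sign, from the same data, so they
  have the same shape. Negative bumps of \<open>u\<close> are positive bumps of \<open>- u\<close>.

  The bound on \<open>\<lambda>\<close> is a Sturm comparison with \<open>sin (\<pi> (x - l) / (r - l))\<close> on one bump
  (\<open>bump_eigenvalue_bound\<close>): since \<open>\<bar>\<phi>\<bar> < \<bar>p\<bar>\<close> away from the critical point, a bump is shorter
  than a half-wave of the linear equation \<open>- u'' = \<lambda> u\<close>, that is, \<open>\<lambda> < \<pi>\<^sup>2 / (r - l)\<^sup>2\<close>. As \<open>n - 1\<close> interior zeros leave a
  gap of length at least \<open>1 / n\<close>, the bound follows.
\<close>

section \<open>The flux as a function of the slope\<close>

definition flux :: "real \<Rightarrow> real \<Rightarrow> real" where
  "flux \<kappa> p = p / sqrt (1 + \<kappa> * p\<^sup>2)"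

lemma sqrt_flux_pos: "\<kappa> > 0 \<Longrightarrow> 0 < sqrt (1 + \<kappa> * p\<^sup>2)" for \<kappa> p :: real
  by (simp add: add_pos_nonneg)

lemma flux_0 [simp]: "flux \<kappa> 0 = 0"
  by (simp add: flux_def)

lemma flux_minus [simp]: "flux \<kappa> (- p) = - flux \<kappa> p"
  by (simp add: flux_def)

lemma has_derivative_flux:
  assumes "\<kappa> > 0"
  shows "(flux \<kappa> has_real_derivative 1 / sqrt (1 + \<kappa> * p\<^sup>2) ^ 3) (at p)"
proof -
  define s where "s = sqrt (1 + \<kappa> * p\<^sup>2)"
  have s: "s > 0" "s\<^sup>2 = 1 + \<kappa> * p\<^sup>2"
    using sqrt_flux_pos[OF assms, of p] assms by (auto simp: s_def)
  have "0 < 1 + \<kappa> * p\<^sup>2"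
    using assms by (simp add: add_pos_nonneg)
  then have "(flux \<kappa> has_real_derivative
      (1 * s - p * (inverse s / 2 * (\<kappa> * (2 * p)))) / (s * s)) (at p)"
    unfolding flux_def[abs_def] s_def
    by (auto intro!: derivative_eq_intros simp: real_sqrt_gt_0_iff)
  moreover have "(1 * s - p * (inverse s / 2 * (\<kappa> * (2 * p)))) / (s * s) = 1 / s ^ 3"
  proof -
    have "s * s - \<kappa> * p * p = 1"
      using s(2) by (simp add: power2_eq_square algebra_simps)
    then show ?thesis
      using s(1) by (simp add: field_simps power3_eq_cube)
  qed
  ultimately show ?thesis by (simp add: s_def)
qed

lemma flux_strict_mono:
  assumes "\<kappa> > 0"
  shows "strict_mono (flux \<kappa>)"
proof (rule strict_monoI)
  fix p q :: real assume "p < q"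
  then show "flux \<kappa> p < flux \<kappa> q"
    by (rule DERIV_pos_imp_increasing)
      (use has_derivative_flux[OF assms] sqrt_flux_pos[OF assms] in force)
qed

lemma flux_less_iff: "\<kappa> > 0 \<Longrightarrow> flux \<kappa> p < flux \<kappa> q \<longleftrightarrow> p < q"
  by (simp add: strict_mono_less flux_strict_mono)

lemma flux_eq_iff: "\<kappa> > 0 \<Longrightarrow> flux \<kappa> p = flux \<kappa> q \<longleftrightarrow> p = q"
  by (simp add: strict_mono_eq flux_strict_mono)

lemma flux_power2_eq_iff:
  assumes "\<kappa> > 0"
  shows "(flux \<kappa> p)\<^sup>2 = (flux \<kappa> q)\<^sup>2 \<longleftrightarrow> p = q \<or> p = - q"
  by (metis assms flux_eq_iff flux_minus power2_eq_iff)

lemma flux_less_slope: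
  assumes "\<kappa> > 0" "p > 0"
  shows "flux \<kappa> p < p"
proof -
  have "1 < sqrt (1 + \<kappa> * p\<^sup>2)" using assms by simp
  then show ?thesis using assms by (simp add: flux_def divide_less_eq)
qed

lemma slope_eq_flux:
  assumes "\<kappa> > 0"
  shows "0 < 1 - \<kappa> * (flux \<kappa> p)\<^sup>2" and "p = flux \<kappa> p / sqrt (1 - \<kappa> * (flux \<kappa> p)\<^sup>2)"
proof -
  have pos: "0 < 1 + \<kappa> * p\<^sup>2" using assms by (simp add: add_pos_nonneg)
  then have *: "1 - \<kappa> * (flux \<kappa> p)\<^sup>2 = 1 / (1 + \<kappa> * p\<^sup>2)"
    by (simp add: flux_def power_divide field_simps)
  then show "0 < 1 - \<kappa> * (flux \<kappa> p)\<^sup>2" using pos by simp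
  show "p = flux \<kappa> p / sqrt (1 - \<kappa> * (flux \<kappa> p)\<^sup>2)"
    unfolding * using sqrt_flux_pos[OF assms, of p] by (simp add: flux_def real_sqrt_divide)
qed

text \<open>
  The derivative of \<open>flux \<kappa>\<close> tends to \<open>0\<close> at infinity, so its inverse is Lipschitz only for slopes in a
  bounded set.
\<close>

lemma slope_lipschitz_in_flux:
  assumes "\<kappa> > 0" "\<bar>p\<bar> \<le> M" "\<bar>q\<bar> \<le> M"
  shows "\<bar>p - q\<bar> \<le> sqrt (1 + \<kappa> * M\<^sup>2) ^ 3 * \<bar>flux \<kappa> p - flux \<kappa> q\<bar>"
  using assms(2,3)
proof (induction p q rule: linorder_wlog)
  case (le p q)
  show ?case
  proof (cases "p = q")
    case False
    then have "p < q" using le by simp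
    then obtain z where z: "p < z" "z < q"
      and eq: "flux \<kappa> q - flux \<kappa> p = (q - p) * (1 / sqrt (1 + \<kappa> * z\<^sup>2) ^ 3)"
      using MVT2[of p q "flux \<kappa>" "\<lambda>z. 1 / sqrt (1 + \<kappa> * z\<^sup>2) ^ 3"]
        has_derivative_flux[OF assms(1)] by blast
    define s where "s = sqrt (1 + \<kappa> * z\<^sup>2)"
    have s: "s > 0" unfolding s_def by (rule sqrt_flux_pos[OF assms(1)])
    have "\<bar>z\<bar> \<le> \<bar>M\<bar>" using z le by linarith
    then have "z\<^sup>2 \<le> M\<^sup>2" by (simp add: abs_le_square_iff)
    then have "s \<le> sqrt (1 + \<kappa> * M\<^sup>2)" using assms(1) by (simp add: s_def)
    then have "s ^ 3 \<le> sqrt (1 + \<kappa> * M\<^sup>2) ^ 3" using s by (intro power_mono) auto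
    then have "s ^ 3 * (flux \<kappa> q - flux \<kappa> p) \<le> sqrt (1 + \<kappa> * M\<^sup>2) ^ 3 * (flux \<kappa> q - flux \<kappa> p)"
      using \<open>p < q\<close> by (intro mult_right_mono) (simp_all add: flux_less_iff assms(1) less_imp_le)
    moreover have "s ^ 3 * (flux \<kappa> q - flux \<kappa> p) = q - p"
      using s eq by (simp add: s_def[symmetric])
    ultimately show ?thesis
      using \<open>p < q\<close> flux_less_iff[OF assms(1), of p q] by (simp add: abs_if)
  qed simp
next
  case (sym p q)
  then show ?case by (simp add: abs_minus_commute)
qed


section \<open>The first-order system\<close>

text \<open>
  The slope \<open>p\<close> is carried as a separate function, and the equations are required only in the
  interior, so that restriction, translation, reflection and change of sign need no discussion of
  one-sided derivatives.
\<close>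

definition solves_on ::
    "real \<Rightarrow> real \<Rightarrow> (real \<Rightarrow> real) \<Rightarrow> (real \<Rightarrow> real) \<Rightarrow> real \<Rightarrow> real \<Rightarrow> bool" where
  "solves_on \<kappa> lam u p a b \<longleftrightarrow>
     continuous_on {a..b} u \<and> continuous_on {a..b} p \<and>
     (\<forall>x\<in>{a<..<b}. (u has_real_derivative p x) (at x) \<and>
        ((\<lambda>y. flux \<kappa> (p y)) has_real_derivative - (lam * u x)) (at x))"

lemma solution_solves_on:
  assumes "solution \<kappa> lam u"
  shows "solves_on \<kappa> lam u (D01 u) 0 1"
proof -
  have d: "u differentiable_on {0..1}" and c: "continuous_on {0..1} (D01 u)"
    using assms by (auto simp: solution_def C2_def C1_def)
  have "(u has_real_derivative D01 u x) (at x)" if x: "x \<in> {0<..<1}" for x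
  proof -
    have within: "at x within {0..1} = at x"
      using x by (intro at_within_interior) simp
    have "u differentiable (at x within {0..1})"
      using d x by (auto simp: differentiable_on_def)
    then have "u differentiable (at x)" unfolding within .
    then have "(u has_vector_derivative vector_derivative u (at x)) (at x)"
      by (simp add: vector_derivative_works)
    then show ?thesis
      by (simp add: has_real_derivative_iff_has_vector_derivative D01_def within)
  qed
  with assms c differentiable_imp_continuous_on[OF d] show ?thesis
    by (auto simp: solves_on_def solution_def flux_def)
qed

lemma solves_on_subset:
  assumes "solves_on \<kappa> lam u p a b" "a \<le> c" "d \<le> b"
  shows "solves_on \<kappa> lam u p c d"
proof -
  have "{c..d} \<subseteq> {a..b}" "{c<..<d} \<subseteq> {a<..<b}" using assms(2,3) by auto
  then show ?thesis
    using assms(1) continuous_on_subset[of "{a..b}" _ "{c..d}"] unfolding solves_on_def by blast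
qed

lemma solves_on_minus:
  assumes "solves_on \<kappa> lam u p a b"
  shows "solves_on \<kappa> lam (\<lambda>x. - u x) (\<lambda>x. - p x) a b"
  using assms unfolding solves_on_def
  by (auto intro!: continuous_intros derivative_eq_intros)

lemma solves_on_shift:
  assumes "solves_on \<kappa> lam u p (a + c) (b + c)"
  shows "solves_on \<kappa> lam (\<lambda>x. u (x + c)) (\<lambda>x. p (x + c)) a b"
proof -
  have cont: "continuous_on {a..b} (\<lambda>x. f (x + c))"
    if "continuous_on {a + c..b + c} f" for f :: "real \<Rightarrow> real"
    by (rule continuous_on_compose2[OF that]) (auto intro!: continuous_intros)
  have der: "((\<lambda>x. f (x + c)) has_real_derivative d) (at x)"
    if "(f has_real_derivative d) (at (x + c))" for f :: "real \<Rightarrow> real" and d x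
    using that by (rule DERIV_shift[THEN iffD1])
  have "(u has_real_derivative p (x + c)) (at (x + c))"
    "((\<lambda>y. flux \<kappa> (p y)) has_real_derivative - (lam * u (x + c))) (at (x + c))"
    if "x \<in> {a<..<b}" for x
    using assms that by (simp_all add: solves_on_def)
  from der[OF this(1)] der[OF this(2)] show ?thesis
    using assms cont[of u] cont[of p] by (simp add: solves_on_def)
qed

lemma solves_on_reflect:
  assumes "solves_on \<kappa> lam u p a b"
  shows "solves_on \<kappa> lam (\<lambda>x. u (a + b - x)) (\<lambda>x. - p (a + b - x)) a b"
proof -
  have cont: "continuous_on {a..b} (\<lambda>x. f (a + b - x))"
    if "continuous_on {a..b} f" for f :: "real \<Rightarrow> real"
    by (rule continuous_on_compose2[OF that]) (auto intro!: continuous_intros)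
  have der: "((\<lambda>x. f (a + b - x)) has_real_derivative - d) (at x)"
    if "(f has_real_derivative d) (at (a + b - x))" for f :: "real \<Rightarrow> real" and d x
  proof -
    have "((\<lambda>x. a + b - x) has_real_derivative - 1) (at x)"
      by (auto intro!: derivative_eq_intros)
    from DERIV_chain2[of f, OF that this] show ?thesis by simp
  qed
  have fd: "((\<lambda>y. flux \<kappa> (p (a + b - y))) has_real_derivative lam * u (a + b - x)) (at x)"
    and ud: "((\<lambda>y. u (a + b - y)) has_real_derivative - p (a + b - x)) (at x)"
    if "x \<in> {a<..<b}" for x
  proof -
    have "a + b - x \<in> {a<..<b}" using that by auto
    then have *: "(u has_real_derivative p (a + b - x)) (at (a + b - x))"
      "((\<lambda>y. flux \<kappa> (p y)) has_real_derivative - (lam * u (a + b - x))) (at (a + b - x))"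
      using assms unfolding solves_on_def by blast+
    show "((\<lambda>y. flux \<kappa> (p (a + b - y))) has_real_derivative lam * u (a + b - x)) (at x)"
      using der[OF *(2)] by simp
    show "((\<lambda>y. u (a + b - y)) has_real_derivative - p (a + b - x)) (at x)"
      using der[OF *(1)] by simp
  qed
  show ?thesis
    using assms cont fd ud DERIV_minus[OF fd] unfolding solves_on_def
    by (auto intro!: continuous_intros)
qed

lemma solves_on_continuous_flux:
  assumes "\<kappa> > 0" "solves_on \<kappa> lam u p a b"
  shows "continuous_on {a..b} (\<lambda>x. flux \<kappa> (p x))"
proof -
  have "continuous_on UNIV (flux \<kappa>)"
    using has_derivative_flux[OF assms(1)]
    by (intro continuous_at_imp_continuous_on ballI DERIV_isCont) blast
  moreover have "continuous_on {a..b} p" using assms(2) by (simp add: solves_on_def)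
  ultimately show ?thesis by (rule continuous_on_compose2) auto
qed

text \<open>
  The kinetic part of the energy is an antiderivative of \<open>p\<close> with respect to the flux, namely
  \<open>- sqrt (1 - \<kappa> \<phi>\<^sup>2) / \<kappa>\<close>; the whole is multiplied by \<open>\<kappa>\<close>.
\<close>

definition energy :: "real \<Rightarrow> real \<Rightarrow> real \<Rightarrow> real \<Rightarrow> real" where
  "energy \<kappa> lam v q = lam * \<kappa> * v\<^sup>2 / 2 - sqrt (1 - \<kappa> * (flux \<kappa> q)\<^sup>2)"

lemma energy_conserved:
  assumes "\<kappa> > 0" "solves_on \<kappa> lam u p a b" "x \<in> {a..b}" "y \<in> {a..b}"
  shows "energy \<kappa> lam (u x) (p x) = energy \<kappa> lam (u y) (p y)"
proof -
  let ?E = "\<lambda>x. energy \<kappa> lam (u x) (p x)"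
  have cont: "continuous_on {a..b} ?E"
    using assms(2) solves_on_continuous_flux[OF assms(1,2)]
    unfolding energy_def solves_on_def by (auto intro!: continuous_intros)
  have deriv: "(?E has_real_derivative 0) (at x)" if "x \<in> {a<..<b}" for x
  proof -
    define s where "s = sqrt (1 - \<kappa> * (flux \<kappa> (p x))\<^sup>2)"
    have s: "s > 0" "p x = flux \<kappa> (p x) / s"
      using slope_eq_flux[OF assms(1), of "p x"] by (auto simp: s_def)
    have d: "(u has_real_derivative p x) (at x)"
      "((\<lambda>y. flux \<kappa> (p y)) has_real_derivative - (lam * u x)) (at x)"
      using assms(2) that by (auto simp: solves_on_def)
    have "(?E has_real_derivative lam * \<kappa> * (2 * u x * p x) / 2
        - inverse s / 2 * (- (\<kappa> * (2 * flux \<kappa> (p x) * - (lam * u x))))) (at x)"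
      unfolding energy_def s_def using slope_eq_flux(1)[OF assms(1), of "p x"]
      by (auto intro!: derivative_eq_intros d simp: real_sqrt_gt_0_iff)
    also have "lam * \<kappa> * (2 * u x * p x) / 2
        - inverse s / 2 * (- (\<kappa> * (2 * flux \<kappa> (p x) * - (lam * u x))))
        = lam * \<kappa> * u x * (p x - flux \<kappa> (p x) / s)"
      by (simp add: field_simps)
    finally show ?thesis using s(2) by simp
  qed
  have "?E x = ?E a" if "x \<in> {a..b}" for x
  proof (cases "a = x")
    case False
    then have "a < b" "a \<le> x" "x \<le> b" using that by auto
    then show ?thesis
      using DERIV_isconst2[of a b ?E x] cont deriv by auto
  qed simp
  from this[OF assms(3)] this[OF assms(4)] show ?thesis by simp
qed

lemma energy_eq_at_zeros:
  assumes "\<kappa> > 0" "energy \<kappa> lam 0 p = energy \<kappa> lam 0 q"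
  shows "p = q \<or> p = - q"
proof -
  have "(flux \<kappa> p)\<^sup>2 = (flux \<kappa> q)\<^sup>2"
    using assms slope_eq_flux(1)[OF assms(1), of p] slope_eq_flux(1)[OF assms(1), of q]
    by (simp add: energy_def)
  then show ?thesis by (simp add: flux_power2_eq_iff assms(1))
qed

text \<open>
  A double zero has the least possible energy \<open>-1\<close>, which is attained only at the origin of the
  phase plane.
\<close>

lemma double_zero_imp_trivial:
  assumes "\<kappa> > 0" "lam > 0" "solves_on \<kappa> lam u p a b"
    and "z \<in> {a..b}" "u z = 0" "p z = 0" "x \<in> {a..b}"
  shows "u x = 0"
proof -
  have "energy \<kappa> lam (u x) (p x) = - 1"
    using energy_conserved[OF assms(1,3,7,4)] assms(5,6) by (simp add: energy_def)
  moreover have "sqrt (1 - \<kappa> * (flux \<kappa> (p x))\<^sup>2) \<le> 1" using assms(1) by simp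
  ultimately have "lam * \<kappa> * (u x)\<^sup>2 \<le> 0" unfolding energy_def by linarith
  then show ?thesis using assms(1,2) by (simp add: mult_le_0_iff)
qed

text \<open>
  Gronwall's argument: the squared distance \<open>w\<close> of the two solutions in the \<open>(u, \<phi>)\<close>-plane satisfies
  \<open>w' \<le> (C + \<lambda>) w\<close>, with \<open>C\<close> the Lipschitz constant of the slope as a function of the flux, so
  \<open>w\<close> times a decaying exponential decreases from \<open>0\<close>.
\<close>

lemma solves_on_unique:
  assumes k: "\<kappa> > 0" and l: "lam > 0"
    and 1: "solves_on \<kappa> lam u p a b" and 2: "solves_on \<kappa> lam v q a b"
    and init: "u a = v a" "p a = q a" and x: "x \<in> {a..b}"
  shows "u x = v x \<and> p x = q x"
proof -
  have cp: "continuous_on {a..b} p" and cq: "continuous_on {a..b} q"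
    using 1 2 by (auto simp: solves_on_def)
  have "bounded (p ` {a..b} \<union> q ` {a..b})"
    using compact_continuous_image[OF cp] compact_continuous_image[OF cq]
    by (simp add: compact_imp_bounded)
  then obtain M where M: "\<And>y. y \<in> p ` {a..b} \<union> q ` {a..b} \<Longrightarrow> \<bar>y\<bar> \<le> M"
    unfolding bounded_iff real_norm_def by blast
  define C where "C = sqrt (1 + \<kappa> * M\<^sup>2) ^ 3"
  have C: "C > 0" using sqrt_flux_pos[OF k, of M] by (simp add: C_def)
  define d where "d y = u y - v y" for y
  define e where "e y = flux \<kappa> (p y) - flux \<kappa> (q y)" for y
  define w where "w y = (d y)\<^sup>2 + (e y)\<^sup>2" for y
  define g where "g y = w y * exp (- (C + lam) * y)" for y
  have cd: "continuous_on {a..b} d" "continuous_on {a..b} e"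
    using 1 2 solves_on_continuous_flux[OF k 1] solves_on_continuous_flux[OF k 2]
    by (auto simp: d_def[abs_def] e_def[abs_def] solves_on_def intro!: continuous_intros)
  then have cg: "continuous_on {a..x} g"
    using x unfolding g_def w_def
    by (auto intro!: continuous_intros intro: continuous_on_subset)
  have dg: "\<exists>D. (g has_real_derivative D) (at y) \<and> D \<le> 0" if y: "a < y" "y < x" for y
  proof -
    have y': "y \<in> {a<..<b}" "y \<in> {a..b}" using x y by auto
    have dd: "(d has_real_derivative p y - q y) (at y)"
      and de: "(e has_real_derivative - (lam * d y)) (at y)"
      using 1 2 y'(1) unfolding solves_on_def d_def[abs_def] e_def[abs_def]
      by (auto intro!: derivative_eq_intros simp: algebra_simps)
    define W where "W = 2 * d y * (p y - q y) - 2 * lam * e y * d y"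
    have "(g has_real_derivative (W - (C + lam) * w y) * exp (- (C + lam) * y)) (at y)"
      unfolding g_def w_def W_def
      by (rule derivative_eq_intros dd de refl)+ (simp add: algebra_simps)
    moreover have "W \<le> (C + lam) * w y"
    proof -
      have "\<bar>p y - q y\<bar> \<le> C * \<bar>e y\<bar>"
        using slope_lipschitz_in_flux[OF k, of "p y" M "q y"] M y'(2) by (auto simp: C_def e_def)
      then have "\<bar>d y\<bar> * \<bar>p y - q y\<bar> \<le> \<bar>d y\<bar> * (C * \<bar>e y\<bar>)"
        by (rule mult_left_mono) simp
      moreover have "W \<le> 2 * (\<bar>d y\<bar> * \<bar>p y - q y\<bar>) + 2 * lam * (\<bar>e y\<bar> * \<bar>d y\<bar>)"
      proof -
        have "d y * (p y - q y) \<le> \<bar>d y\<bar> * \<bar>p y - q y\<bar>"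
          by (metis abs_ge_self abs_mult)
        moreover have "- (e y * d y) \<le> \<bar>e y\<bar> * \<bar>d y\<bar>"
          by (metis abs_ge_minus_self abs_mult)
        then have "lam * - (e y * d y) \<le> lam * (\<bar>e y\<bar> * \<bar>d y\<bar>)"
          using l by (intro mult_left_mono) auto
        ultimately show ?thesis by (simp add: W_def algebra_simps)
      qed
      ultimately have "W \<le> (C + lam) * (2 * \<bar>d y\<bar> * \<bar>e y\<bar>)"
        by (simp add: algebra_simps)
      also have "\<dots> \<le> (C + lam) * w y"
        using sum_squares_bound[of "\<bar>d y\<bar>" "\<bar>e y\<bar>"] C l
        by (intro mult_left_mono) (simp_all add: w_def)
      finally show ?thesis .
    qed
    ultimately show ?thesis
      by (meson diff_le_0_iff_le exp_ge_zero mult_nonpos_nonneg)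
  qed
  have "g x \<le> g a"
    using DERIV_nonpos_imp_decreasing_open[of a x g] x dg cg by auto
  also have "g a = 0" using init by (simp add: g_def w_def d_def e_def)
  finally have "w x \<le> 0" by (simp add: g_def mult_le_0_iff)
  then have "d x = 0 \<and> e x = 0" unfolding w_def by (simp add: sum_power2_le_zero_iff)
  then show ?thesis by (simp add: d_def e_def flux_eq_iff[OF k])
qed


section \<open>Positive bumps\<close>

lemma bump_slope_decreasing:
  assumes k: "\<kappa> > 0" and lam: "lam > 0" and s: "solves_on \<kappa> lam u p l r"
    and pos: "\<And>x. x \<in> {l<..<r} \<Longrightarrow> u x > 0" and xy: "l \<le> x" "x < y" "y \<le> r"
  shows "p y < p x"
proof -
  have "flux \<kappa> (p y) < flux \<kappa> (p x)"
  proof (rule DERIV_neg_imp_decreasing_open[OF xy(2)])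
    fix z assume "x < z" "z < y"
    then have "z \<in> {l<..<r}" using xy by auto
    then show "\<exists>D. ((\<lambda>x. flux \<kappa> (p x)) has_real_derivative D) (at z) \<and> D < 0"
      using s pos[of z] lam unfolding solves_on_def
      by (intro exI[of _ "- (lam * u z)"]) auto
  next
    show "continuous_on {x..y} (\<lambda>x. flux \<kappa> (p x))"
      using solves_on_continuous_flux[OF k s] xy by (auto intro: continuous_on_subset)
  qed
  then show ?thesis by (simp add: flux_less_iff k)
qed

text \<open>Equal energies leave only \<open>p r = p l\<close>, which monotonicity excludes, or \<open>p r = - p l\<close>.\<close>

lemma bump_end_slopes:
  assumes k: "\<kappa> > 0" and lam: "lam > 0" and s: "solves_on \<kappa> lam u p l r" and lr: "l < r"
    and pos: "\<And>x. x \<in> {l<..<r} \<Longrightarrow> u x > 0" and ends: "u l = 0" "u r = 0"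
  shows "p r = - p l" and "p l > 0"
proof -
  have less: "p r < p l" using bump_slope_decreasing[OF k lam s pos] lr by simp
  have "energy \<kappa> lam 0 (p r) = energy \<kappa> lam 0 (p l)"
    using energy_conserved[OF k s, of r l] lr ends by simp
  then show "p r = - p l" using energy_eq_at_zeros[OF k] less by fastforce
  then show "p l > 0" using less by simp
qed

lemma bump_symmetric:
  assumes k: "\<kappa> > 0" and lam: "lam > 0" and s: "solves_on \<kappa> lam u p l r" and lr: "l < r"
    and pos: "\<And>x. x \<in> {l<..<r} \<Longrightarrow> u x > 0" and ends: "u l = 0" "u r = 0"
    and x: "x \<in> {l..r}"
  shows "u x = u (l + r - x)" and "p x = - p (l + r - x)"
proof -
  have "u l = u (l + r - l)" "p l = - p (l + r - l)"
    using ends bump_end_slopes(1)[OF k lam s lr pos ends] by simp_all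
  from solves_on_unique[OF k lam s solves_on_reflect[OF s] this x]
  show "u x = u (l + r - x)" and "p x = - p (l + r - x)" by blast+
qed

lemma bump_critical_point:
  assumes k: "\<kappa> > 0" and lam: "lam > 0" and s: "solves_on \<kappa> lam u p l r" and lr: "l < r"
    and pos: "\<And>x. x \<in> {l<..<r} \<Longrightarrow> u x > 0" and ends: "u l = 0" "u r = 0"
  shows "{x \<in> {l<..<r}. p x = 0} = {midpoint l r}"
proof -
  let ?m = "midpoint l r"
  have m: "l < ?m" "?m < r" "l + r - ?m = ?m" using lr by (auto simp: midpoint_def field_simps)
  have p0: "p ?m = 0"
    using bump_symmetric(2)[OF k lam s lr pos ends, of ?m] m by simp
  have "x = ?m" if "x \<in> {l<..<r}" "p x = 0" for x
    using bump_slope_decreasing[OF k lam s pos, of x ?m]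
      bump_slope_decreasing[OF k lam s pos, of ?m x] that p0 m
    by (cases x ?m rule: linorder_cases) auto
  then show ?thesis using p0 m by auto
qed

lemma shorter_bump_same_shape:
  assumes k: "\<kappa> > 0" and lam: "lam > 0"
    and s: "solves_on \<kappa> lam u p l r" and lr: "l < r" and ends: "u l = 0" "u r = 0"
    and s': "solves_on \<kappa> lam v q l' r'" and ends': "v l' = 0"
    and pos': "\<And>x. x \<in> {l'<..<r'} \<Longrightarrow> v x > 0"
    and start: "p l = q l'" and le: "r - l \<le> r' - l'"
  shows "r - l = r' - l' \<and> (\<forall>x\<in>{l..r}. v (x + (l' - l)) = u x)"
proof -
  let ?c = "l' - l"
  have "solves_on \<kappa> lam v q (l + ?c) (r + ?c)"
    using solves_on_subset[OF s'] le by simp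
  then have "solves_on \<kappa> lam (\<lambda>x. v (x + ?c)) (\<lambda>x. q (x + ?c)) l r"
    by (rule solves_on_shift)
  from solves_on_unique[OF k lam s this] ends ends' start
  have eq: "u x = v (x + ?c)" if "x \<in> {l..r}" for x
    using that by auto
  \<comment> \<open>\<open>v\<close> vanishes at the translate of \<open>r\<close>, which therefore cannot be interior to \<open>(l', r')\<close>.\<close>
  have "v (r + ?c) = 0" using eq[of r] ends lr by simp
  then have "r + ?c \<notin> {l'<..<r'}" using pos' by force
  then show ?thesis using eq lr le by auto
qed

lemma bumps_same_shape:
  assumes k: "\<kappa> > 0" and lam: "lam > 0"
    and s: "solves_on \<kappa> lam u p l r" and lr: "l < r" and ends: "u l = 0" "u r = 0"
    and pos: "\<And>x. x \<in> {l<..<r} \<Longrightarrow> u x > 0"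
    and s': "solves_on \<kappa> lam v q l' r'" and lr': "l' < r'" and ends': "v l' = 0" "v r' = 0"
    and pos': "\<And>x. x \<in> {l'<..<r'} \<Longrightarrow> v x > 0"
    and start: "p l = q l'"
  shows "\<exists>c. {l'<..<r'} = (\<lambda>x. x + c) ` {l<..<r} \<and> (\<forall>x\<in>{l<..<r}. v (x + c) = u x)"
proof -
  have "r - l = r' - l' \<and> (\<forall>x\<in>{l..r}. v (x + (l' - l)) = u x)"
  proof (cases "r - l \<le> r' - l'")
    case True
    then show ?thesis
      using shorter_bump_same_shape[OF k lam s lr ends s' ends'(1) pos' start] by blast
  next
    case False
    then have *: "r' - l' = r - l" "\<forall>x\<in>{l'..r'}. u (x + (l - l')) = v x"
      using shorter_bump_same_shape[OF k lam s' lr' ends' s ends(1) pos start[symmetric]] by auto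
    with False show ?thesis by simp
  qed
  then have *: "r' = r + (l' - l)" and eq: "\<forall>x\<in>{l..r}. v (x + (l' - l)) = u x" by auto
  have "{l'<..<r'} = (\<lambda>x. x + (l' - l)) ` {l<..<r}"
  proof (intro set_eqI iffI)
    fix y assume "y \<in> {l'<..<r'}"
    then show "y \<in> (\<lambda>x. x + (l' - l)) ` {l<..<r}"
      using * by (intro image_eqI[of _ _ "y - (l' - l)"]) auto
  qed (use * in auto)
  then show ?thesis using eq by (intro exI[of _ "l' - l"]) auto
qed

text \<open>
  Sturm comparison on the left half \<open>[l, m]\<close> of the bump. With \<open>\<omega> = \<pi> / (r - l)\<close> and
  \<open>s x = sin (\<omega> (x - l))\<close>, the Wronskian-like function \<open>W = \<phi> s - u s'\<close> vanishes at \<open>l\<close>, where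
  \<open>u = s = 0\<close>, and at \<open>m\<close>, where \<open>\<phi> = s' = 0\<close>. Since
  \<open>W' = (\<omega>\<^sup>2 - \<lambda>) u s - (p - \<phi>) s'\<close> and \<open>p > \<phi>\<close> on \<open>(l, m)\<close>, it would be strictly decreasing if
  \<open>\<lambda> \<ge> \<omega>\<^sup>2\<close>.
\<close>

lemma bump_eigenvalue_bound:
  assumes k: "\<kappa> > 0" and lam: "lam > 0" and s: "solves_on \<kappa> lam u p l r" and lr: "l < r"
    and pos: "\<And>x. x \<in> {l<..<r} \<Longrightarrow> u x > 0" and ends: "u l = 0" "u r = 0"
  shows "lam * (r - l)\<^sup>2 < pi\<^sup>2"
proof (rule ccontr)
  assume contra: "\<not> lam * (r - l)\<^sup>2 < pi\<^sup>2"
  define \<omega> where "\<omega> = pi / (r - l)"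
  have \<omega>: "\<omega> > 0" "\<omega> * (r - l) = pi" using lr by (auto simp: \<omega>_def)
  have lam_ge: "\<omega>\<^sup>2 \<le> lam"
    using contra lr by (simp add: \<omega>_def power_divide divide_le_eq)
  define m where "m = midpoint l r"
  have m: "l < m" "m < r" using lr by (auto simp: m_def midpoint_def field_simps)
  have wm: "\<omega> * (m - l) = pi / 2" using \<omega>(2) by (simp add: m_def midpoint_def field_simps)
  have pm: "p m = 0" using bump_critical_point[OF k lam s lr pos ends] by (auto simp: m_def)
  define W where "W x = flux \<kappa> (p x) * sin (\<omega> * (x - l)) - u x * (\<omega> * cos (\<omega> * (x - l)))" for x
  have "W m < W l"
  proof (rule DERIV_neg_imp_decreasing_open[OF m(1)])
    fix x assume x: "l < x" "x < m"
    then have x': "x \<in> {l<..<r}" using m by simp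
    have "\<omega> * (x - l) < pi / 2"
      unfolding wm[symmetric] using \<omega>(1) x by simp
    moreover have "0 < \<omega> * (x - l)" using \<omega>(1) x by simp
    ultimately have sc: "sin (\<omega> * (x - l)) > 0" "cos (\<omega> * (x - l)) > 0"
      by (auto intro!: sin_gt_zero cos_gt_zero)
    have "p x > 0" using bump_slope_decreasing[OF k lam s pos, of x m] x m pm by simp
    then have "flux \<kappa> (p x) < p x" by (rule flux_less_slope[OF k])
    then have neg: "(flux \<kappa> (p x) - p x) * (\<omega> * cos (\<omega> * (x - l))) < 0"
      using sc \<omega>(1) by (simp add: mult_neg_pos)
    have nonpos: "(\<omega>\<^sup>2 - lam) * (u x * sin (\<omega> * (x - l))) \<le> 0"
      using lam_ge pos[OF x'] sc by (intro mult_nonpos_nonneg) auto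
    have d: "(u has_real_derivative p x) (at x)"
      "((\<lambda>y. flux \<kappa> (p y)) has_real_derivative - (lam * u x)) (at x)"
      using s x' by (auto simp: solves_on_def)
    have "(W has_real_derivative (\<omega>\<^sup>2 - lam) * (u x * sin (\<omega> * (x - l)))
        + (flux \<kappa> (p x) - p x) * (\<omega> * cos (\<omega> * (x - l)))) (at x)"
      unfolding W_def
      by (rule derivative_eq_intros d refl)+ (simp add: algebra_simps power2_eq_square)
    then show "\<exists>D. (W has_real_derivative D) (at x) \<and> D < 0"
      using neg nonpos by (meson add_nonpos_neg)
  next
    have "continuous_on {l..m} u" "continuous_on {l..m} (\<lambda>x. flux \<kappa> (p x))"
      using solves_on_continuous_flux[OF k s] s m unfolding solves_on_def
      by (auto intro: continuous_on_subset)
    then show "continuous_on {l..m} W"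
      unfolding W_def by (intro continuous_intros)
  qed
  moreover have "W l = 0" by (simp add: W_def ends)
  moreover have "W m = 0" by (simp add: W_def pm wm)
  ultimately show False by simp
qed


section \<open>Locating the bumps\<close>

text \<open>
  The end-points are the zeros nearest to a given point of the interval on either side. They exist
  because \<open>f\<close> vanishes at \<open>0\<close> and \<open>1\<close>, which also makes the interval open.
\<close>

lemma maximal_positive_interval:
  fixes f :: "real \<Rightarrow> real"
  assumes cont: "continuous_on {0..1} f" and f: "f 0 = 0" "f 1 = 0"
    and I: "maximal_interval (\<lambda>x. f x > 0) I"
  obtains l r where "0 \<le> l" "l < r" "r \<le> 1" "I = {l<..<r}" "f l = 0" "f r = 0"
    "\<And>x. x \<in> {l<..<r} \<Longrightarrow> f x > 0"
proof -
  obtain x where x: "x \<in> I" using I by (auto simp: maximal_interval_def)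
  have ivI: "is_interval I" and I01: "I \<subseteq> {0..1}" and posI: "\<And>y. y \<in> I \<Longrightarrow> f y > 0"
    and max: "\<And>J. is_interval J \<Longrightarrow> J \<subseteq> {0..1} \<Longrightarrow> \<forall>y\<in>J. f y > 0 \<Longrightarrow> I \<subseteq> J \<Longrightarrow> J = I"
    using I by (auto simp: maximal_interval_def)
  have x01: "x \<in> {0..1}" and fx: "f x > 0" using x I01 posI by auto
  define Zl where "Zl = {z \<in> {0..x}. f z = 0}"
  define Zr where "Zr = {z \<in> {x..1}. f z = 0}"
  have "continuous_on {0..x} f" "continuous_on {x..1} f"
    using cont x01 by (auto intro: continuous_on_subset)
  then have "closed Zl" "closed Zr"
    unfolding Zl_def Zr_def
    by (blast intro: continuous_closed_preimage_constant closed_atLeastAtMost)+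
  moreover have ne: "0 \<in> Zl" "1 \<in> Zr" using x01 f by (auto simp: Zl_def Zr_def)
  moreover have bdd: "bdd_above Zl" "bdd_below Zr" by (auto simp: Zl_def Zr_def)
  ultimately have mem: "Sup Zl \<in> Zl" "Inf Zr \<in> Zr"
    by (auto intro: closed_contains_Sup closed_contains_Inf)
  define l where "l = Sup Zl"
  define r where "r = Inf Zr"
  have l: "0 \<le> l" "l < x" "f l = 0" and r: "x < r" "r \<le> 1" "f r = 0"
    using mem fx by (auto simp: Zl_def Zr_def l_def r_def order.order_iff_strict)
  have nz: "f y \<noteq> 0" if "y \<in> {l<..<r}" for y
  proof
    assume 0: "f y = 0"
    show False
    proof (cases "y \<le> x")
      case True
      then have "y \<in> Zl" using 0 that l by (auto simp: Zl_def)
      then have "y \<le> l" unfolding l_def using bdd(1) by (rule cSup_upper)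
      then show False using that by simp
    next
      case False
      then have "y \<in> Zr" using 0 that r by (auto simp: Zr_def)
      then have "r \<le> y" unfolding r_def using bdd(2) by (rule cInf_lower)
      then show False using that by simp
    qed
  qed
  have pos: "f y > 0" if y: "y \<in> {l<..<r}" for y
  proof (rule ccontr)
    assume "\<not> f y > 0"
    then have neg: "f y < 0" using nz[OF y] by linarith
    have "is_interval (f ` {l<..<r})"
      unfolding is_interval_connected_1
      using l r by (intro connected_continuous_image continuous_on_subset[OF cont]) auto
    moreover have "f y \<in> f ` {l<..<r}" "f x \<in> f ` {l<..<r}" using y l r by auto
    ultimately have "0 \<in> f ` {l<..<r}"
      using neg fx unfolding is_interval_1 by (meson less_imp_le)
    then show False using nz by auto
  qed
  have "I \<subseteq> {l<..<r}"
  proof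
    fix y assume y: "y \<in> I"
    have "l \<notin> I" "r \<notin> I" using posI[of l] posI[of r] l r by auto
    then show "y \<in> {l<..<r}"
      using ivI x y l r unfolding is_interval_1 greaterThanLessThan_iff
      by (meson less_imp_le not_less)
  qed
  then have "I = {l<..<r}"
    using max[of "{l<..<r}"] pos l r by (force simp: is_interval_oo)
  then show ?thesis using that[of l r] l r pos by simp
qed

text \<open>
  Pigeonhole. If the first gap is shorter than its fair share, the remaining points lie in an
  interval that is long enough for the induction.
\<close>

lemma finite_set_large_gap:
  fixes Z :: "real set"
  assumes "finite Z" "Z \<subseteq> {a<..<b}" "a < b"
  shows "\<exists>l r. l \<in> insert a (insert b Z) \<and> r \<in> insert a (insert b Z) \<and> a \<le> l \<and> l < r \<and> r \<le> b \<and>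
    {l<..<r} \<inter> Z = {} \<and> b - a \<le> (real (card Z) + 1) * (r - l)"
  using assms
proof (induction "card Z" arbitrary: Z a)
  case 0
  then have "Z = {}" by simp
  then show ?case using 0 by (intro exI[of _ a] exI[of _ b]) auto
next
  case (Suc k)
  then have ne: "Z \<noteq> {}" by auto
  define z where "z = Min Z"
  have z: "z \<in> Z" "\<And>y. y \<in> Z \<Longrightarrow> z \<le> y" using ne Suc.prems by (auto simp: z_def)
  have az: "a < z" "z < b" using z Suc.prems by auto
  show ?case
  proof (cases "b - a \<le> (real (card Z) + 1) * (z - a)")
    case True
    have "{a<..<z} \<inter> Z = {}" using z(2) by force
    then show ?thesis using True z az by (intro exI[of _ a] exI[of _ z]) auto
  next
    case False
    have card: "k = card (Z - {z})" using Suc.hyps(2) Suc.prems z by simp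
    have "Z - {z} \<subseteq> {z<..<b}" using z(2) Suc.prems by (force simp: order.strict_iff_order)
    from Suc.hyps(1)[OF card _ this az(2)] Suc.prems
    obtain l r where lr: "l \<in> insert z (insert b (Z - {z}))" "r \<in> insert z (insert b (Z - {z}))"
      "z \<le> l" "l < r" "r \<le> b" "{l<..<r} \<inter> (Z - {z}) = {}" "b - z \<le> (real k + 1) * (r - l)"
      using card by auto
    have "(real k + 2) * (b - z) \<ge> (real k + 1) * (b - a)"
      using False Suc.hyps(2)[symmetric] by (simp add: algebra_simps)
    also have "(real k + 2) * (b - z) \<le> (real k + 2) * ((real k + 1) * (r - l))"
      using lr(7) by (intro mult_left_mono) auto
    finally have "(real k + 1) * (b - a) \<le> (real k + 1) * ((real k + 2) * (r - l))"
      by (simp add: algebra_simps)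
    then have "b - a \<le> (real k + 2) * (r - l)"
      by (rule mult_left_le_imp_le) simp
    then have "b - a \<le> (real (card Z) + 1) * (r - l)"
      using Suc.hyps(2)[symmetric] by (simp add: algebra_simps)
    moreover have "{l<..<r} \<inter> Z = {}" using lr(3,6) by force
    ultimately show ?thesis using lr(1-5) z(1) az by (intro exI[of _ l] exI[of _ r]) auto
  qed
qed

lemma constant_sign_without_zeros:
  fixes f :: "real \<Rightarrow> real"
  assumes "continuous_on {l<..<r} f" "\<And>x. x \<in> {l<..<r} \<Longrightarrow> f x \<noteq> 0"
  shows "(\<forall>x\<in>{l<..<r}. f x > 0) \<or> (\<forall>x\<in>{l<..<r}. - f x > 0)"
proof (rule ccontr)
  assume "\<not> ?thesis"
  then obtain x y where xy: "x \<in> {l<..<r}" "f x \<le> 0" "y \<in> {l<..<r}" "f y \<ge> 0" by force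
  have "is_interval (f ` {l<..<r})"
    unfolding is_interval_connected_1 using assms(1) by (intro connected_continuous_image) auto
  then have "0 \<in> f ` {l<..<r}"
    using xy unfolding is_interval_1 by (meson imageI)
  then show False using assms(2) by auto
qed


section \<open>Solutions with a prescribed number of simple zeros\<close>

text \<open>
  The sign condition excludes the trivial solution, so by the energy every zero is simple. The
  \<open>n - 1\<close> simple zeros are therefore all the interior zeros, and a gap between neighbouring ones
  is a bump of \<open>u\<close> or of \<open>- u\<close>.
\<close>

lemma nodal_eigenvalue_bound:
  assumes k: "\<kappa> > 0" and n: "n \<ge> 1" and lam: "lam > 0"
    and sol: "solution \<kappa> lam u" and S: "u \<in> S n \<nu>"
  shows "lam < (real n)\<^sup>2 * pi\<^sup>2"
proof -
  note s = solution_solves_on[OF sol]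
  have u01: "u 0 = 0" "u 1 = 0" using sol by (auto simp: solution_def)
  have cont: "continuous_on {0..1} u" using s by (simp add: solves_on_def)
  define Z where "Z = {\<tau> \<in> {0<..<1}. simple_zero u \<tau>}"
  have Z: "finite Z" "card Z = n - 1" using S by (auto simp: S_def Z_def)
  obtain \<epsilon> where \<epsilon>: "\<epsilon> > 0" "\<And>x. x \<in> {0<..<\<epsilon>} \<Longrightarrow> \<nu> * u x > 0" using S by (auto simp: S_def)
  define x0 where "x0 = min (\<epsilon> / 2) (1 / 2)"
  have "x0 \<in> {0<..<\<epsilon>}" "x0 \<in> {0..1}" using \<epsilon>(1) by (auto simp: x0_def min_def)
  then have nontrivial: "x0 \<in> {0..1}" "u x0 \<noteq> 0" using \<epsilon>(2)[of x0] by auto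
  have simple: "D01 u z \<noteq> 0" if "z \<in> {0..1}" "u z = 0" for z
    using double_zero_imp_trivial[OF k lam s that(1,2) _ nontrivial(1)] nontrivial(2) by blast
  have zeros: "x \<in> Z" if "x \<in> {0<..<1}" "u x = 0" for x
    using simple[of x] that by (auto simp: Z_def simple_zero_def)
  have "Z \<subseteq> {0<..<1}" by (auto simp: Z_def)
  from finite_set_large_gap[OF Z(1) this] obtain l r
    where lr: "l \<in> insert 0 (insert 1 Z)" "r \<in> insert 0 (insert 1 Z)" "0 \<le> l" "l < r" "r \<le> 1"
      "{l<..<r} \<inter> Z = {}" "1 \<le> (real (card Z) + 1) * (r - l)"
    by auto
  have gap: "1 \<le> real n * (r - l)" using lr(7) Z(2) n by simp
  have ends: "u l = 0" "u r = 0" using lr(1,2) u01 by (auto simp: Z_def simple_zero_def)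
  have sub: "{l<..<r} \<subseteq> {0<..<1}" using lr by auto
  have nz: "u x \<noteq> 0" if "x \<in> {l<..<r}" for x
    using that zeros[of x] lr(6) sub by blast
  have "continuous_on {l<..<r} u"
    using sub by (intro continuous_on_subset[OF cont]) auto
  then have "(\<forall>x\<in>{l<..<r}. u x > 0) \<or> (\<forall>x\<in>{l<..<r}. - u x > 0)"
    using nz by (rule constant_sign_without_zeros)
  moreover note s' = solves_on_subset[OF s lr(3,5)]
  ultimately have "lam * (r - l)\<^sup>2 < pi\<^sup>2"
    using bump_eigenvalue_bound[OF k lam s' lr(4)] ends
      bump_eigenvalue_bound[OF k lam solves_on_minus[OF s'] lr(4)] by auto
  then have bound: "(real n)\<^sup>2 * (lam * (r - l)\<^sup>2) < (real n)\<^sup>2 * pi\<^sup>2"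
    using n by simp
  have "1 \<le> (real n * (r - l))\<^sup>2" using gap by simp
  then have "lam * 1 \<le> lam * (real n * (r - l))\<^sup>2"
    using lam by (intro mult_left_mono) auto
  also have "\<dots> = (real n)\<^sup>2 * (lam * (r - l)\<^sup>2)"
    by (simp add: power_mult_distrib)
  finally show ?thesis using bound by simp
qed

lemma negative_bump_iff: "negative_bump u I \<longleftrightarrow> positive_bump (\<lambda>x. - u x) I"
  by (simp add: negative_bump_def positive_bump_def)

text \<open>
  A pair \<open>v, q\<close> stands for \<open>u, u'\<close> or for \<open>- u, - u'\<close>, so that bumps of both signs are covered.
\<close>

lemma positive_bump_shape:
  assumes k: "\<kappa> > 0" and lam: "lam > 0" and s: "solves_on \<kappa> lam v q 0 1"
    and v: "v 0 = 0" "v 1 = 0" and B: "positive_bump v B"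
  shows "\<exists>l r. l < r \<and> B = {l<..<r} \<and> symmetric_on v l r \<and>
           strict_antimono_on B q \<and> {x \<in> B. q x = 0} = {midpoint l r}"
proof -
  have "continuous_on {0..1} v" using s by (simp add: solves_on_def)
  from maximal_positive_interval[OF this v B[unfolded positive_bump_def]]
  obtain l r where lr: "0 \<le> l" "l < r" "r \<le> 1" "B = {l<..<r}" "v l = 0" "v r = 0"
    and pos: "\<And>x. x \<in> {l<..<r} \<Longrightarrow> v x > 0"
    by blast
  note s' = solves_on_subset[OF s lr(1,3)]
  have "symmetric_on v l r"
    unfolding symmetric_on_def
    by (intro ballI bump_symmetric(1)[OF k lam s' lr(2) pos lr(5,6)]) auto
  moreover have "strict_antimono_on B q"
    unfolding lr(4) using bump_slope_decreasing[OF k lam s' pos] by (intro monotone_onI) auto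
  ultimately show ?thesis
    using lr bump_critical_point[OF k lam s' lr(2) pos lr(5,6)] by blast
qed

text \<open>
  The bumps of \<open>v\<close> and of \<open>v'\<close> start with slopes which are positive and, having equal energy with
  \<open>v = v' = 0\<close>, are the same.
\<close>

lemma positive_bumps_same_shape:
  assumes k: "\<kappa> > 0" and lam: "lam > 0"
    and s: "solves_on \<kappa> lam v q 0 1" and v: "v 0 = 0" "v 1 = 0" and B: "positive_bump v B"
    and s': "solves_on \<kappa> lam v' q' 0 1" and v': "v' 0 = 0" "v' 1 = 0" and B': "positive_bump v' B'"
    and same: "q 0 = q' 0 \<or> q 0 = - q' 0"
  shows "\<exists>c. B' = (\<lambda>x. x + c) ` B \<and> (\<forall>x\<in>B. v' (x + c) = v x)"
proof -
  have "continuous_on {0..1} v" "continuous_on {0..1} v'"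
    using s s' by (simp_all add: solves_on_def)
  from maximal_positive_interval[OF this(1) v B[unfolded positive_bump_def]]
    maximal_positive_interval[OF this(2) v' B'[unfolded positive_bump_def]]
  obtain l r l' r' where lr: "0 \<le> l" "l < r" "r \<le> 1" "B = {l<..<r}" "v l = 0" "v r = 0"
    and pos: "\<And>x. x \<in> {l<..<r} \<Longrightarrow> v x > 0"
    and lr': "0 \<le> l'" "l' < r'" "r' \<le> 1" "B' = {l'<..<r'}" "v' l' = 0" "v' r' = 0"
    and pos': "\<And>x. x \<in> {l'<..<r'} \<Longrightarrow> v' x > 0"
    by metis
  note t = solves_on_subset[OF s lr(1,3)] and t' = solves_on_subset[OF s' lr'(1,3)]
  have "energy \<kappa> lam 0 (q l) = energy \<kappa> lam 0 (q 0)"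
    using energy_conserved[OF k s, of l 0] lr v by simp
  also have "\<dots> = energy \<kappa> lam 0 (q' 0)"
    using same by (auto simp: energy_def)
  also have "\<dots> = energy \<kappa> lam 0 (q' l')"
    using energy_conserved[OF k s', of l' 0] lr' v' by simp
  finally have "q l = q' l' \<or> q l = - q' l'" by (rule energy_eq_at_zeros[OF k])
  moreover have "q l > 0" "q' l' > 0"
    using bump_end_slopes(2)[OF k lam t lr(2) pos lr(5,6)]
      bump_end_slopes(2)[OF k lam t' lr'(2) pos' lr'(5,6)] by auto
  ultimately have "q l = q' l'" by auto
  from bumps_same_shape[OF k lam t lr(2,5,6) pos t' lr'(2,5,6) pos' this]
  show ?thesis unfolding lr(4) lr'(4) .
qed

theorem lemma2p2:
  fixes \<kappa> lam \<nu> :: real and n :: nat and u :: "real \<Rightarrow> real"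
  assumes "\<kappa> > 0" and "n \<ge> 1" and "\<nu> \<in> {1, -1}" and "lam > 0"
    and "solution \<kappa> lam u" and "u \<in> S n \<nu>"
  shows "(0 < lam \<and> lam < (real n)\<^sup>2 * pi\<^sup>2) \<and>
    ((\<forall>B B'. positive_bump u B \<and> positive_bump u B' \<longrightarrow> same_shape u B B') \<and>
     (\<forall>B. positive_bump u B \<longrightarrow>
        (\<exists>l r. l < r \<and> B = {l<..<r} \<and> symmetric_on u l r \<and>
           strict_antimono_on B (D01 u) \<and> {x \<in> B. D01 u x = 0} = {midpoint l r}))) \<and>
    ((\<forall>D D'. negative_bump u D \<and> negative_bump u D' \<longrightarrow> same_shape u D D') \<and>
     (\<forall>D. negative_bump u D \<longrightarrow>
        (\<exists>l r. l < r \<and> D = {l<..<r} \<and> symmetric_on u l r \<and>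
           strict_mono_on D (D01 u) \<and> {x \<in> D. D01 u x = 0} = {midpoint l r}))) \<and>
    (\<forall>B D. positive_bump u B \<and> negative_bump u D \<longrightarrow> same_shape_opp u B D)"
proof (intro conjI allI impI)
  note k = assms(1) and lam = assms(4)
  note s = solution_solves_on[OF assms(5)]
  note s' = solves_on_minus[OF s]
  have u: "u 0 = 0" "u 1 = 0" using assms(5) by (auto simp: solution_def)
  then have u': "- u 0 = 0" "- u 1 = 0" by auto
  show "0 < lam" by (rule lam)
  show "lam < (real n)\<^sup>2 * pi\<^sup>2" by (rule nodal_eigenvalue_bound[OF assms(1,2,4,5,6)])
  show "same_shape u B B'" if "positive_bump u B \<and> positive_bump u B'" for B B'
    unfolding same_shape_def
    using positive_bumps_same_shape[OF k lam s u _ s u, of B B'] that by simp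
  show "\<exists>l r. l < r \<and> B = {l<..<r} \<and> symmetric_on u l r \<and>
      strict_antimono_on B (D01 u) \<and> {x \<in> B. D01 u x = 0} = {midpoint l r}"
    if "positive_bump u B" for B
    by (rule positive_bump_shape[OF k lam s u that])
  show "same_shape u D D'" if "negative_bump u D \<and> negative_bump u D'" for D D'
    unfolding same_shape_def
    using positive_bumps_same_shape[OF k lam s' u' _ s' u', of D D'] that
    by (simp add: negative_bump_iff)
  show "\<exists>l r. l < r \<and> D = {l<..<r} \<and> symmetric_on u l r \<and>
      strict_mono_on D (D01 u) \<and> {x \<in> D. D01 u x = 0} = {midpoint l r}"
    if "negative_bump u D" for D
    using positive_bump_shape[OF k lam s' u' that[unfolded negative_bump_iff]]
    by (simp add: symmetric_on_def monotone_on_def)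
  show "same_shape_opp u B D" if "positive_bump u B \<and> negative_bump u D" for B D
  proof -
    have "\<exists>c. D = (\<lambda>x. x + c) ` B \<and> (\<forall>x\<in>B. - u (x + c) = u x)"
      using positive_bumps_same_shape[OF k lam s u _ s' u', of B D] that
      by (simp add: negative_bump_iff)
    then show ?thesis
      unfolding same_shape_opp_def by (metis minus_minus)
  qed
qed

end
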